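(* For integers $s\ge 1$ and $\ell\ge 2$ let $T_{s,\ell}$ be the subdivided symmetric double star and $\lambda_{s,\ell}:=\lambda_{\max}(R_{T_{s,\ell}})$; for $s>3$ let $\lambda_{s,\infty}:=\lim_{\ell\to\infty}\lambda_{s,\ell}$. Then: (1) $\lambda_{s,2}=\dfrac{\sqrt{s+1}-2}{s+1}$; (2) for each fixed $\ell\ge 2$, $\lambda_{s,\ell}=\sqrt{\dfrac{2}{\ell(s+1)}}+O\left((s+1)^{-1}\right)$ as $s\to\infty$; (3) $\lambda_{s,\infty}=2^{1/3}(s+1)^{-2/3}+o\left((s+1)^{-2/3}\right)$ as $s\to\infty$.
   Context: For a finite tree $T=(V,E)$ let $d_z$ denote the degree of the vertex $z$. The Ricci matrix $R_T\in\mathbb R^{E\times E}$ is the real symmetric matrix indexed by edges with entries $(R_T)_{e,e}=-\left(\frac1{d_x}+\frac1{d_y}\right)$ for $e=\{x,y\}$, $(R_T)_{e,e'}=\frac1{d_z}$ if $e\ne e'$ and $e\cap e'=\{z\}$, and $(R_T)_{e,e'}=0$ if $e\cap e'=\varnothing$. $\lambda_{\max}(M)$ denotes the largest eigenvalue of a real symmetric matrix $M$. The symmetric double star $S_{s,s}$ consists of two adjacent centers, each having $s$ leaf neighbours. $T_{s,\ell}$ is obtained from $S_{s,s}$ by replacing the central edge with a path of length $\ell$ between the two centers; the two centers have degree $s+1$ and the $\ell-1$ interior chain vertices have degree $2$. For $s>3$ the limit $\lambda_{s,\infty}$ exists and is the unique positive solution $\lambda$ of $1+\lambda-\sqrt{\lambda(\lambda+2)}=2\lambda+1+\frac{2}{s+1}-\frac{2s}{(s+1)((s+1)\lambda+3)}$.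 In (2) the implied constant may depend on $\ell$. *)

theory Defs
  imports "Jordan_Normal_Form.Spectral_Radius" "HOL-Library.Landau_Symbols"
begin

text \<open>A finite simple graph without isolated vertices is given by its set of edges, an edge being
  the two-element set of its endpoints.\<close>

definition vdegree :: "'v set set \<Rightarrow> 'v \<Rightarrow> nat" where
  "vdegree E z = card {e \<in> E. z \<in> e}"

definition ricci :: "'v set set \<Rightarrow> 'v set \<Rightarrow> 'v set \<Rightarrow> real" where
  "ricci E e e' =
     (if e = e' then - (\<Sum>z\<in>e. 1 / real (vdegree E z))
      else if \<exists>z. e \<inter> e' = {z} then 1 / real (vdegree E (the_elem (e \<inter> e')))
      else 0)"

text \<open>To speak about eigenvalues of a matrix with a finite index set, its indices are numbered in
  an arbitrary way; by \<open>eigenvalue_indexed_mat\<close> below the choice is irrelevant.\<close>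

definition enum_list :: "'i set \<Rightarrow> 'i list" where
  "enum_list I = (SOME xs. distinct xs \<and> set xs = I)"

definition indexed_mat :: "'i set \<Rightarrow> ('i \<Rightarrow> 'i \<Rightarrow> real) \<Rightarrow> real mat" where
  "indexed_mat I M =
     mat (card I) (card I) (\<lambda>(i, j). M (enum_list I ! i) (enum_list I ! j))"

definition ricci_mat :: "'v set set \<Rightarrow> real mat" where
  "ricci_mat E = indexed_mat E (ricci E)"

definition lambda_max :: "real mat \<Rightarrow> real" where
  "lambda_max A = Max (spectrum A)"

datatype vertex = Chain nat | Leaf1 nat | Leaf2 nat

text \<open>The path between the centers \<open>Chain 0\<close> and \<open>Chain l\<close> runs through
  \<open>Chain 1, \<dots>, Chain (l - 1)\<close>; the leaves at the two centers are \<open>Leaf1 i\<close> and \<open>Leaf2 i\<close>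
  for \<open>i < s\<close>. For \<open>l = 1\<close> this is the symmetric double star itself.\<close>

definition sub_double_star :: "nat \<Rightarrow> nat \<Rightarrow> vertex set set" where
  "sub_double_star s l =
     (\<lambda>i. {Chain i, Chain (Suc i)}) ` {..<l}
     \<union> (\<lambda>i. {Chain 0, Leaf1 i}) ` {..<s}
     \<union> (\<lambda>i. {Chain l, Leaf2 i}) ` {..<s}"

definition lambda_T :: "nat \<Rightarrow> nat \<Rightarrow> real" where
  "lambda_T s l = lambda_max (ricci_mat (sub_double_star s l))"

definition lambda_T_inf :: "nat \<Rightarrow> real" where
  "lambda_T_inf s = lim (\<lambda>l. lambda_T s l)"

lemma enum_list:
  assumes "finite I"
  shows "distinct (enum_list I)" "set (enum_list I) = I" "length (enum_list I) = card I"
proof -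
  have "\<exists>xs. distinct xs \<and> set xs = I"
    using finite_distinct_list[OF assms] by blast
  then have *: "distinct (enum_list I) \<and> set (enum_list I) = I"
    unfolding enum_list_def by (rule someI_ex)
  then show "distinct (enum_list I)" "set (enum_list I) = I" by auto
  with distinct_card show "length (enum_list I) = card I" by metis
qed

lemma eigenvalue_indexed_mat:
  assumes fin: "finite I"
  shows "eigenvalue (indexed_mat I M) k \<longleftrightarrow>
    (\<exists>v. (\<exists>i\<in>I. v i \<noteq> 0) \<and> (\<forall>i\<in>I. (\<Sum>j\<in>I. M i j * v j) = k * v i))"
proof -
  define xs where "xs = enum_list I"
  define n where "n = card I"
  have xs: "distinct xs" "set xs = I" "length xs = n"
    using enum_list[OF fin] by (auto simp: xs_def n_def)
  have bij: "bij_betw (\<lambda>i. xs ! i) {0..<n} I"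
    using bij_betw_nth[OF xs(1), of "{0..<n}" I] xs by (auto simp: atLeast0LessThan)
  let ?A = "indexed_mat I M"
  have A: "?A = mat n n (\<lambda>(i, j). M (xs ! i) (xs ! j))"
    by (simp add: indexed_mat_def xs_def n_def)
  have mult: "(?A *\<^sub>v w) $ i = (\<Sum>j\<in>{0..<n}. M (xs ! i) (xs ! j) * w $ j)"
    if "dim_vec w = n" "i < n" for w i
    using that unfolding A by (simp add: scalar_prod_def)
  show ?thesis
  proof
    assume "eigenvalue ?A k"
    then obtain w where w: "w \<in> carrier_vec n" "w \<noteq> 0\<^sub>v n" "?A *\<^sub>v w = k \<cdot>\<^sub>v w"
      unfolding eigenvalue_def eigenvector_def A by auto
    have dw: "dim_vec w = n" using w(1) by auto
    define v where "v x = w $ (the_inv_into {0..<n} (\<lambda>i. xs ! i) x)" for x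
    have v: "v (xs ! i) = w $ i" if "i < n" for i
      using that bij unfolding v_def bij_betw_def by (simp add: the_inv_into_f_f)
    obtain i where i: "i < n" "w $ i \<noteq> 0"
    proof (rule ccontr)
      assume "\<not> thesis"
      then have "\<And>i. i < n \<Longrightarrow> w $ i = 0" using that by blast
      then have "w = 0\<^sub>v n" using dw by (intro eq_vecI) auto
      then show False using w(2) by simp
    qed
    have "(\<Sum>j\<in>I. M x j * v j) = k * v x" if x: "x \<in> I" for x
    proof -
      obtain m where m: "m < n" "x = xs ! m" using x xs by (metis in_set_conv_nth)
      have "(\<Sum>j\<in>I. M x j * v j) = (\<Sum>j\<in>{0..<n}. M x (xs ! j) * v (xs ! j))"
        using sum.reindex_bij_betw[OF bij, of "\<lambda>j. M x j * v j"] by simp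
      also have "\<dots> = (?A *\<^sub>v w) $ m" using mult[OF dw m(1)] m v by simp
      also have "\<dots> = k * v x" using w(3) dw m v by simp
      finally show ?thesis .
    qed
    moreover have "xs ! i \<in> I" using i xs by auto
    moreover have "v (xs ! i) \<noteq> 0" using i v by simp
    ultimately show "\<exists>v. (\<exists>i\<in>I. v i \<noteq> 0) \<and> (\<forall>i\<in>I. (\<Sum>j\<in>I. M i j * v j) = k * v i)"
      by blast
  next
    assume "\<exists>v. (\<exists>i\<in>I. v i \<noteq> 0) \<and> (\<forall>i\<in>I. (\<Sum>j\<in>I. M i j * v j) = k * v i)"
    then obtain v x where v: "x \<in> I" "v x \<noteq> 0"
      "\<And>i. i \<in> I \<Longrightarrow> (\<Sum>j\<in>I. M i j * v j) = k * v i" by blast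
    define w where "w = vec n (\<lambda>i. v (xs ! i))"
    obtain m where m: "m < n" "x = xs ! m" using v(1) xs by (metis in_set_conv_nth)
    have "w $ m \<noteq> 0" using m v by (simp add: w_def)
    then have nz: "w \<noteq> 0\<^sub>v n" using m by auto
    have "?A *\<^sub>v w = k \<cdot>\<^sub>v w"
    proof (rule eq_vecI)
      fix i assume "i < dim_vec (k \<cdot>\<^sub>v w)"
      then have i: "i < n" by (simp add: w_def)
      have "(?A *\<^sub>v w) $ i = (\<Sum>j\<in>{0..<n}. M (xs ! i) (xs ! j) * v (xs ! j))"
        using mult[of w i] i by (simp add: w_def)
      also have "\<dots> = (\<Sum>j\<in>I. M (xs ! i) j * v j)"
        using sum.reindex_bij_betw[OF bij, of "\<lambda>j. M (xs ! i) j * v j"] by simp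
      also have "\<dots> = k * v (xs ! i)" using v(3) i xs by auto
      finally show "(?A *\<^sub>v w) $ i = (k \<cdot>\<^sub>v w) $ i" using i by (simp add: w_def)
    qed (simp add: A w_def)
    then show "eigenvalue ?A k"
      unfolding eigenvalue_def eigenvector_def using nz by (intro exI[of _ w]) (auto simp: A w_def)
  qed
qed

lemma finite_sub_double_star: "finite (sub_double_star s l)"
  by (simp add: sub_double_star_def)

lemma mem_sub_double_star:
  "e \<in> sub_double_star s l \<longleftrightarrow>
     (\<exists>i<l. e = {Chain i, Chain (Suc i)}) \<or>
     (\<exists>i<s. e = {Chain 0, Leaf1 i}) \<or> (\<exists>i<s. e = {Chain l, Leaf2 i})"
  by (auto simp: sub_double_star_def)

lemma vdegree_center1:
  assumes "l \<ge> 1"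
  shows "vdegree (sub_double_star s l) (Chain 0) = s + 1"
proof -
  let ?L = "(\<lambda>i. {Chain 0, Leaf1 i}) ` {..<s}"
  have "{e \<in> sub_double_star s l. Chain 0 \<in> e} = insert {Chain 0, Chain 1} ?L"
    (is "?A = ?B")
  proof
    show "?A \<subseteq> ?B" using assms by (auto simp: mem_sub_double_star)
    have "{Chain 0, Chain 1} \<in> sub_double_star s l"
      unfolding mem_sub_double_star using assms by (intro disjI1 exI[of _ 0]) auto
    then show "?B \<subseteq> ?A" by (auto simp: mem_sub_double_star)
  qed
  moreover have "card ?L = s"
    by (subst card_image) (auto simp: inj_on_def doubleton_eq_iff)
  moreover have "{Chain 0, Chain 1} \<notin> ?L" by (auto simp: doubleton_eq_iff)
  ultimately show ?thesis by (simp add: vdegree_def)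
qed

lemma vdegree_center2:
  assumes "l \<ge> 1"
  shows "vdegree (sub_double_star s l) (Chain l) = s + 1"
proof -
  let ?L = "(\<lambda>i. {Chain l, Leaf2 i}) ` {..<s}"
  obtain k where l: "l = Suc k" using assms by (cases l) auto
  have "{e \<in> sub_double_star s l. Chain l \<in> e} = insert {Chain k, Chain l} ?L"
    (is "?A = ?B")
  proof
    show "?A \<subseteq> ?B" unfolding l by (auto simp: mem_sub_double_star)
    have "{Chain k, Chain l} \<in> sub_double_star s l"
      unfolding mem_sub_double_star using l by (intro disjI1 exI[of _ k]) auto
    then show "?B \<subseteq> ?A" by (auto simp: mem_sub_double_star)
  qed
  moreover have "card ?L = s"
    by (subst card_image) (auto simp: inj_on_def doubleton_eq_iff)
  moreover have "{Chain k, Chain l} \<notin> ?L" by (auto simp: doubleton_eq_iff)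
  ultimately show ?thesis by (simp add: vdegree_def)
qed

lemma vdegree_interior:
  assumes "0 < i" "i < l"
  shows "vdegree (sub_double_star s l) (Chain i) = 2"
proof -
  obtain k where i: "i = Suc k" using assms by (cases i) auto
  have "{e \<in> sub_double_star s l. Chain i \<in> e} =
      {{Chain k, Chain i}, {Chain i, Chain (Suc i)}}"
    (is "?A = ?B")
  proof
    show "?A \<subseteq> ?B" using assms unfolding i by (auto simp: mem_sub_double_star)
    have "{Chain k, Chain i} \<in> sub_double_star s l" "{Chain i, Chain (Suc i)} \<in> sub_double_star s l"
      using assms i Suc_lessD unfolding mem_sub_double_star by blast+
    then show "?B \<subseteq> ?A" by auto
  qed
  moreover have "{Chain k, Chain i} \<noteq> {Chain i, Chain (Suc i)}"
    using i by (auto simp: doubleton_eq_iff)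
  ultimately show ?thesis by (simp add: vdegree_def)
qed

lemma vdegree_leaf:
  assumes "i < s"
  shows "vdegree (sub_double_star s l) (Leaf1 i) = 1"
    and "vdegree (sub_double_star s l) (Leaf2 i) = 1"
proof -
  have "{e \<in> sub_double_star s l. Leaf1 i \<in> e} = {{Chain 0, Leaf1 i}}"
    and "{e \<in> sub_double_star s l. Leaf2 i \<in> e} = {{Chain l, Leaf2 i}}"
    using assms by (auto simp: sub_double_star_def)
  then show "vdegree (sub_double_star s l) (Leaf1 i) = 1"
    and "vdegree (sub_double_star s l) (Leaf2 i) = 1"
    by (simp_all add: vdegree_def)
qed

end

theory Submission
  imports Defs "HOL-Real_Asymp.Real_Asymp"
begin

text \<open>An eigenvector of the Ricci matrix with positive entries belongs to the largest eigenvalue,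
  because the off-diagonal entries are nonnegative. Write \<open>d = s + 1\<close>. A symmetric eigenvector
  for \<open>x\<close> has entries \<open>cosh ((2 * i + 1 - l) * t)\<close> along the chain, where \<open>cosh (2 * t) = 1 + x\<close>,
  and a common value on the leaf edges. The equations at the centers then say that the ratio
  \<open>r\<^sub>l x = cosh ((l + 1) * t) / cosh ((l - 1) * t)\<close> equals
  \<open>F x = 1 - 2 / d + 2 * s / (d * (d * x + 3))\<close>. Since \<open>r\<^sub>l\<close> increases and \<open>F\<close> decreases in \<open>x\<close>,
  comparing the two at test points bounds the eigenvalue. The ratios satisfy
  \<open>r\<^sub>l\<^sub>+\<^sub>2 = 2 * (1 + x) - 1 / r\<^sub>l\<close>, which gives \<open>r\<^sub>l x = 1 + l * x + O(x\<^sup>2)\<close> and their increase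
  in \<open>l\<close> to \<open>1 + x + sqrt (x * (x + 2))\<close>.\<close>

section \<open>Comparison with a positive eigenvector\<close>

text \<open>Perron-type argument: at an index \<open>i\<close> maximising
  \<open>\<bar>w i\<bar> / v i\<close>, the row sum for \<open>w\<close>, multiplied by the sign of
  \<open>w i\<close>, is bounded termwise by \<open>t\<close> times the row sum for
  \<open>v\<close>. The diagonal terms agree, so the diagonal entry may have either sign.\<close>

lemma eigenvalue_le_of_positive_eigenvector:
  fixes M :: "'i \<Rightarrow> 'i \<Rightarrow> real"
  assumes fin: "finite I"
    and offdiag: "\<And>i j. i \<in> I \<Longrightarrow> j \<in> I \<Longrightarrow> i \<noteq> j \<Longrightarrow> 0 \<le> M i j"
    and pos: "\<And>i. i \<in> I \<Longrightarrow> 0 < v i"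
    and eig: "\<And>i. i \<in> I \<Longrightarrow> (\<Sum>j\<in>I. M i j * v j) = k * v i"
    and m: "eigenvalue (indexed_mat I M) m"
  shows "m \<le> k"
proof -
  obtain w x where x: "x \<in> I" "w x \<noteq> 0"
    and w: "\<And>i. i \<in> I \<Longrightarrow> (\<Sum>j\<in>I. M i j * w j) = m * w i"
    using m unfolding eigenvalue_indexed_mat[OF fin] by blast
  define t where "t = Max ((\<lambda>i. \<bar>w i\<bar> / v i) ` I)"
  have le: "\<bar>w i\<bar> \<le> t * v i" if "i \<in> I" for i
  proof -
    have "\<bar>w i\<bar> / v i \<le> t" unfolding t_def using fin that by (intro Max_ge) auto
    then show ?thesis using pos[OF that] by (simp add: pos_divide_le_eq)
  qed
  have "t \<in> (\<lambda>i. \<bar>w i\<bar> / v i) ` I" unfolding t_def using fin x by (intro Max_in) auto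
  then obtain i where i: "i \<in> I" "t = \<bar>w i\<bar> / v i" by blast
  have wi: "\<bar>w i\<bar> = t * v i" using i pos[OF i(1)] by simp
  have "0 < \<bar>w x\<bar>" using x by simp
  then have "0 < t * v x" using le[OF x(1)] by linarith
  then have "0 < t" using pos[OF x(1)] by (simp add: zero_less_mult_iff)
  then have wi0: "0 < \<bar>w i\<bar>" using wi pos[OF i(1)] by simp
  have "m * \<bar>w i\<bar> = sgn (w i) * (m * w i)" by (simp add: abs_sgn mult_ac)
  also have "\<dots> = (\<Sum>j\<in>I. M i j * (sgn (w i) * w j))"
    by (simp add: w[OF i(1), symmetric] sum_distrib_left mult_ac)
  also have "\<dots> \<le> (\<Sum>j\<in>I. M i j * (t * v j))"
  proof (rule sum_mono)
    fix j assume j: "j \<in> I"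
    show "M i j * (sgn (w i) * w j) \<le> M i j * (t * v j)"
    proof (cases "i = j")
      case True
      then show ?thesis using wi by (simp add: abs_sgn mult_ac)
    next
      case False
      have "sgn (w i) * w j \<le> \<bar>w j\<bar>" by (cases "w i" "0::real" rule: linorder_cases) auto
      then have "sgn (w i) * w j \<le> t * v j" using le[OF j] by linarith
      then show ?thesis using offdiag[OF i(1) j False] by (rule mult_left_mono)
    qed
  qed
  also have "\<dots> = t * (\<Sum>j\<in>I. M i j * v j)" by (simp add: sum_distrib_left mult_ac)
  also have "\<dots> = k * \<bar>w i\<bar>" by (simp only: eig[OF i(1)] wi mult.left_commute)
  finally show ?thesis using wi0 by simp
qed

lemma lambda_max_eq_of_positive_eigenvector:
  fixes M :: "'i \<Rightarrow> 'i \<Rightarrow> real"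
  assumes "finite I" "I \<noteq> {}"
    and "\<And>i j. i \<in> I \<Longrightarrow> j \<in> I \<Longrightarrow> i \<noteq> j \<Longrightarrow> 0 \<le> M i j"
    and pos: "\<And>i. i \<in> I \<Longrightarrow> 0 < v i"
    and eig: "\<And>i. i \<in> I \<Longrightarrow> (\<Sum>j\<in>I. M i j * v j) = k * v i"
  shows "lambda_max (indexed_mat I M) = k"
  unfolding lambda_max_def
proof (rule Max_eqI)
  have "indexed_mat I M \<in> carrier_mat (card I) (card I)" by (simp add: indexed_mat_def)
  then show "finite (spectrum (indexed_mat I M))" by (rule card_finite_spectrum)
  obtain i where "i \<in> I" using assms(2) by blast
  then have "eigenvalue (indexed_mat I M) k"
    unfolding eigenvalue_indexed_mat[OF assms(1)] using pos eig by (intro exI[of _ v]) force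
  then show "k \<in> spectrum (indexed_mat I M)" by (simp add: spectrum_def)
  show "m \<le> k" if "m \<in> spectrum (indexed_mat I M)" for m
    using eigenvalue_le_of_positive_eigenvector[OF assms(1,3-5)] that
    by (simp add: spectrum_def)
qed

section \<open>The Ricci matrix acting on functions of edges\<close>

text \<open>Distinct edges share at most one vertex, so at most one summand survives; for
  \<open>e = e'\<close> both endpoints contribute. Entries written as sums over endpoints allow the
  matrix product to be regrouped by vertex.\<close>

lemma ricci_eq_sum:
  assumes "card e = 2" "card e' = 2"
  shows "ricci E e e' =
    (\<Sum>z\<in>e. if z \<in> e' then (if e = e' then - 1 else 1) / real (vdegree E z) else 0)"
proof (cases "e = e'")
  case True
  then show ?thesis by (simp add: ricci_def sum_negf)
next
  case False
  have fin: "finite e" "finite e'" using assms by (auto intro: card_ge_0_finite)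
  have eq: "(\<Sum>z\<in>e. if z \<in> e' then (if e = e' then - 1 else 1) / real (vdegree E z) else 0)
      = (\<Sum>z\<in>e \<inter> e'. 1 / real (vdegree E z))"
    using False fin by (simp add: sum.inter_restrict)
  have "card (e \<inter> e') < 2"
  proof (rule ccontr)
    assume "\<not> card (e \<inter> e') < 2"
    then have "e \<inter> e' = e" "e \<inter> e' = e'"
      using assms fin card_seteq[of e "e \<inter> e'"] card_seteq[of e' "e \<inter> e'"] by auto
    then show False using False by simp
  qed
  then have "card (e \<inter> e') = 0 \<or> card (e \<inter> e') = 1" by linarith
  then consider "e \<inter> e' = {}" | z where "e \<inter> e' = {z}"
    using fin by (auto simp: card_1_singleton_iff)
  then show ?thesis
    unfolding eq using False by cases (auto simp: ricci_def)
qed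

text \<open>After exchanging the sums, each endpoint \<open>z\<close> collects \<open>v\<close> over
  all edges at \<open>z\<close>. The edge \<open>e\<close> is counted there with sign
  \<open>+1\<close>, but the matrix gives it \<open>-1\<close>; hence the correction
  \<open>2 * v e\<close>.\<close>

lemma ricci_mult:
  assumes fin: "finite E" and two: "\<And>e. e \<in> E \<Longrightarrow> card e = 2" and e: "e \<in> E"
  shows "(\<Sum>e'\<in>E. ricci E e e' * v e') =
    (\<Sum>z\<in>e. ((\<Sum>e'\<in>{e' \<in> E. z \<in> e'}. v e') - 2 * v e) / real (vdegree E z))"
proof -
  have "(\<Sum>e'\<in>E. ricci E e e' * v e') =
    (\<Sum>e'\<in>E. \<Sum>z\<in>e. (if z \<in> e' then (if e = e' then - 1 else 1) * v e' else 0)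
      / real (vdegree E z))"
  proof (rule sum.cong[OF refl])
    fix e' assume "e' \<in> E"
    then have "ricci E e e' =
        (\<Sum>z\<in>e. if z \<in> e' then (if e = e' then - 1 else 1) / real (vdegree E z) else 0)"
      by (intro ricci_eq_sum two e)
    then show "ricci E e e' * v e' = (\<Sum>z\<in>e.
        (if z \<in> e' then (if e = e' then - 1 else 1) * v e' else 0) / real (vdegree E z))"
      by (simp only: sum_distrib_right) (rule sum.cong[OF refl], simp)
  qed
  also have "\<dots> = (\<Sum>z\<in>e. (\<Sum>e'\<in>E. if z \<in> e' then (if e = e' then - 1 else 1) * v e' else 0)
      / real (vdegree E z))"
    by (subst sum.swap) (simp add: sum_divide_distrib)
  also have "\<dots> = (\<Sum>z\<in>e. ((\<Sum>e'\<in>{e' \<in> E. z \<in> e'}. v e') - 2 * v e) / real (vdegree E z))"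
  proof (rule sum.cong[OF refl])
    fix z assume z: "z \<in> e"
    have "(\<Sum>e'\<in>E. if z \<in> e' then (if e = e' then - 1 else 1) * v e' else 0) =
      (\<Sum>e'\<in>E. (if z \<in> e' then v e' else 0) - (if e = e' then 2 * v e else 0))"
      using z by (intro sum.cong) auto
    also have "\<dots> = (\<Sum>e'\<in>{e' \<in> E. z \<in> e'}. v e') - 2 * v e"
      using fin e by (simp add: sum_subtractf sum.inter_filter)
    finally show "(\<Sum>e'\<in>E. if z \<in> e' then (if e = e' then - 1 else 1) * v e' else 0)
      / real (vdegree E z) = ((\<Sum>e'\<in>{e' \<in> E. z \<in> e'}. v e') - 2 * v e) / real (vdegree E z)"
      by simp
  qed
  finally show ?thesis .
qed

section \<open>Symmetric eigenvectors of the subdivided double star\<close>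

lemma card_mem_sub_double_star: "e \<in> sub_double_star s l \<Longrightarrow> card e = 2"
  by (auto simp: mem_sub_double_star)

lemma incident_edges:
  assumes "l = Suc k"
  shows "{e \<in> sub_double_star s l. Chain 0 \<in> e} =
      insert {Chain 0, Chain 1} ((\<lambda>i. {Chain 0, Leaf1 i}) ` {..<s})"
    and "{e \<in> sub_double_star s l. Chain l \<in> e} =
      insert {Chain k, Chain l} ((\<lambda>i. {Chain l, Leaf2 i}) ` {..<s})"
    and "i < k \<Longrightarrow> {e \<in> sub_double_star s l. Chain (Suc i) \<in> e} =
      {{Chain i, Chain (Suc i)}, {Chain (Suc i), Chain (Suc (Suc i))}}"
    and "i < s \<Longrightarrow> {e \<in> sub_double_star s l. Leaf1 i \<in> e} = {{Chain 0, Leaf1 i}}"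
    and "i < s \<Longrightarrow> {e \<in> sub_double_star s l. Leaf2 i \<in> e} = {{Chain l, Leaf2 i}}"
  using assms by (force simp: sub_double_star_def)+

text \<open>An edge is only a set of vertices, so a chain edge is recognised by having no leaf
  endpoint, and its number is its smaller chain index.\<close>

definition edge_weight :: "(nat \<Rightarrow> real) \<Rightarrow> real \<Rightarrow> vertex set \<Rightarrow> real" where
  "edge_weight c u e = (if e \<subseteq> range Chain then c (LEAST i. Chain i \<in> e) else u)"

lemma edge_weight_simps:
  "edge_weight c u {Chain i, Chain (Suc i)} = c i"
  "edge_weight c u {Chain i, Leaf1 j} = u"
  "edge_weight c u {Chain i, Leaf2 j} = u"
proof -
  have "(LEAST j. Chain j \<in> {Chain i, Chain (Suc i)}) = i"
    by (rule Least_equality) auto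
  then show "edge_weight c u {Chain i, Chain (Suc i)} = c i"
    unfolding edge_weight_def by auto
qed (auto simp: edge_weight_def)

text \<open>For \<open>l = n + 2\<close> the chain edges are numbered \<open>0\<close> to
  \<open>n + 1\<close>. One equation remains per type of edge: \<open>leaf\<close> and
  \<open>center\<close> at the first center, carried to the second one by \<open>sym\<close>, and
  \<open>chain\<close> between interior vertices, with denominators cleared.\<close>

lemma lambda_T_eqI:
  fixes c :: "nat \<Rightarrow> real"
  assumes c_pos: "\<And>i. i < Suc (Suc n) \<Longrightarrow> 0 < c i" and u_pos: "0 < u"
    and sym: "c (Suc n) = c 0" "c n = c 1"
    and leaf: "c 0 = ((real s + 1) * x + 3) * u"
    and center: "(real s * u - c 0) / (real s + 1) + (c 1 - c 0) / 2 = x * c 0"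
    and chain: "\<And>i. i < n \<Longrightarrow> c i + c (Suc (Suc i)) = 2 * (1 + x) * c (Suc i)"
  shows "lambda_T s (Suc (Suc n)) = x"
proof -
  define l where "l = Suc (Suc n)"
  define E where "E = sub_double_star s l"
  define v where "v = edge_weight c u"
  note v = edge_weight_simps[of c u, folded v_def]
  have l: "l = Suc (Suc n)" "1 \<le> l" by (simp_all add: l_def)
  note inc = incident_edges[OF l(1), where s = s, folded E_def]
  have S0: "(\<Sum>e\<in>{e \<in> E. Chain 0 \<in> e}. v e) = c 0 + real s * u"
  proof -
    have "inj_on (\<lambda>i. {Chain 0, Leaf1 i}) {..<s}" by (auto simp: inj_on_def doubleton_eq_iff)
    then show ?thesis unfolding inc(1)
      by (subst sum.insert)
        (auto simp: sum.reindex v v(1)[of 0, simplified] doubleton_eq_iff)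
  qed
  have Sl: "(\<Sum>e\<in>{e \<in> E. Chain l \<in> e}. v e) = c 0 + real s * u"
  proof -
    have "inj_on (\<lambda>i. {Chain l, Leaf2 i}) {..<s}" by (auto simp: inj_on_def doubleton_eq_iff)
    then show ?thesis unfolding inc(2)
      by (subst sum.insert)
        (auto simp: sum.reindex v v(1)[of "Suc n", folded l(1)] sym doubleton_eq_iff)
  qed
  have Sc: "(\<Sum>e\<in>{e \<in> E. Chain (Suc i) \<in> e}. v e) = c i + c (Suc i)" if "i \<le> n" for i
    using that unfolding inc(3)[OF le_imp_less_Suc[OF that]]
    by (subst sum.insert) (auto simp: v doubleton_eq_iff)
  have deg: "vdegree E (Chain 0) = s + 1" "vdegree E (Chain l) = s + 1"
    "\<And>i. i \<le> n \<Longrightarrow> vdegree E (Chain (Suc i)) = 2"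
    using vdegree_center1[OF l(2)] vdegree_center2[OF l(2)] vdegree_interior
    by (auto simp: E_def l)
  have eig: "(\<Sum>e'\<in>E. ricci E e e' * v e') = x * v e" if e: "e \<in> E" for e
  proof -
    have mult: "(\<Sum>e'\<in>E. ricci E e e' * v e') =
        (\<Sum>z\<in>e. ((\<Sum>e'\<in>{e' \<in> E. z \<in> e'}. v e') - 2 * v e) / real (vdegree E z))"
      using e card_mem_sub_double_star finite_sub_double_star unfolding E_def
      by (intro ricci_mult) auto
    have d0: "real s + 1 \<noteq> 0" by (metis add.commute of_nat_Suc of_nat_neq_0)
    \<comment> \<open>The leaf vertex has degree \<open>1\<close> and contributes
      \<open>u - 2 * u\<close>. Multiplying by \<open>s + 1\<close> produces the constant
      \<open>3 = 2 + (s + 1) - s\<close> of \<open>leaf\<close>.\<close>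
    have leaf_eq: "(c 0 + real s * u - 2 * u) / (real s + 1) + (u - 2 * u) = x * u"
      using d0 leaf by (simp add: field_simps)
    consider i where "i < l" "e = {Chain i, Chain (Suc i)}"
      | i where "i < s" "e = {Chain 0, Leaf1 i}"
      | i where "i < s" "e = {Chain l, Leaf2 i}"
      using e unfolding E_def mem_sub_double_star by blast
    then show ?thesis
    proof cases
      case 1
      have eq: "(\<Sum>e'\<in>E. ricci E e e' * v e') =
          ((\<Sum>e'\<in>{e' \<in> E. Chain i \<in> e'}. v e') - 2 * c i) / real (vdegree E (Chain i)) +
          ((\<Sum>e'\<in>{e' \<in> E. Chain (Suc i) \<in> e'}. v e') - 2 * c i) / real (vdegree E (Chain (Suc i)))"
        unfolding mult unfolding 1(2) by (simp add: v)
      \<comment> \<open>The first and last chain edges touch a center, all others have two endpoints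
        of degree \<open>2\<close>.\<close>
      consider "i = 0" | "i = Suc n" | j where "i = Suc j" "j < n"
        using 1(1) unfolding l(1) by (cases i) fastforce+
      then show ?thesis
      proof cases
        case i: 1
        show ?thesis unfolding eq using center unfolding 1(2) v i
          by (simp add: S0 Sc deg add.commute)
      next
        case i: 2
        show ?thesis unfolding eq using center unfolding 1(2) v i
          by (simp add: Sl[unfolded l] Sc deg deg(2)[unfolded l] sym add.commute)
      next
        case i: 3
        show ?thesis unfolding eq using chain[OF i(2)] i(2) unfolding 1(2) v i
          by (simp add: Sc deg field_simps)
      qed
    next
      case 2
      show ?thesis unfolding mult unfolding 2(2) using leaf_eq inc(4)[OF 2(1)]
        vdegree_leaf(1)[OF 2(1), of l, folded E_def]
        by (simp add: v S0 deg add.commute)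
    next
      case 3
      show ?thesis unfolding mult unfolding 3(2) using leaf_eq inc(5)[OF 3(1)]
        vdegree_leaf(2)[OF 3(1), of l, folded E_def]
        by (simp add: v Sl deg add.commute)
    qed
  qed
  have "lambda_max (indexed_mat E (ricci E)) = x"
  proof (rule lambda_max_eq_of_positive_eigenvector[OF _ _ _ _ eig])
    show "finite E" by (simp add: E_def finite_sub_double_star)
    have "{Chain 0, Chain 1} \<in> E" using inc(1) by blast
    then show "E \<noteq> {}" by blast
    show "0 \<le> ricci E e e'" if "e \<noteq> e'" for e e' using that by (simp add: ricci_def)
    show "0 < v e" if "e \<in> E" for e
      using that c_pos u_pos unfolding E_def mem_sub_double_star l(1) by (auto simp: v)
  qed
  then show ?thesis by (simp add: lambda_T_def ricci_mat_def E_def l)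
qed

section \<open>Chains of length two\<close>

text \<open>An explicit vector is used because for \<open>s \<le> 3\<close> the eigenvalue is not
  positive.\<close>

lemma lambda_T_2:
  assumes "s \<ge> 1"
  shows "lambda_T s 2 = (sqrt (real s + 1) - 2) / (real s + 1)"
proof -
  define q where "q = sqrt (real s + 1)"
  have q: "real s + 1 = q\<^sup>2" "q > 0" by (simp_all add: q_def)
  have s: "real s = (q - 1) * (q + 1)" using q(1) by (simp add: power2_eq_square algebra_simps)
  have "lambda_T s (Suc (Suc 0)) = (q - 2) / q\<^sup>2"
  \<comment> \<open>By symmetry both chain edges may carry \<open>1\<close>. Eliminating
    \<open>x\<close> from the leaf and center equations leaves
    \<open>s * u\<^sup>2 + 2 * u = 1\<close>, whose positive root is
    \<open>1 / (q + 1)\<close>.\<close>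
  proof (rule lambda_T_eqI[where c = "\<lambda>_. 1" and u = "1 / (q + 1)"])
    show "1 = ((real s + 1) * ((q - 2) / q\<^sup>2) + 3) * (1 / (q + 1))"
      using q by simp
    show "(real s * (1 / (q + 1)) - 1) / (real s + 1) + (1 - 1) / 2 = (q - 2) / q\<^sup>2 * 1"
      unfolding q(1) unfolding s using q(2) by simp
  qed (use q in auto)
  then show ?thesis unfolding q(1)[symmetric] q_def[symmetric] by (simp add: numeral_2_eq_2)
qed


section \<open>Ratios along the chain\<close>

lemma cosh_add_cosh_diff: "cosh (a + b) + cosh (a - b) = 2 * cosh b * cosh a" for a b :: real
  by (simp add: cosh_add cosh_diff)

text \<open>\<open>chain_ratio l\<close> is \<open>r\<^sub>l\<close> and \<open>star_ratio s\<close> is \<open>F\<close> in the introduction.\<close>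

fun chain_ratio :: "nat \<Rightarrow> real \<Rightarrow> real" where
  "chain_ratio 0 x = 1"
| "chain_ratio (Suc 0) x = 1 + x"
| "chain_ratio (Suc (Suc n)) x = 2 * (1 + x) - 1 / chain_ratio n x"

text \<open>Two-step induction expanding \<open>1 / r\<close> around \<open>r = 1\<close>:
  \<open>1 - y \<le> 1 / r\<close> gives the upper bound, and the geometric expansion to second
  order gives the lower one. A step adds \<open>y\<^sup>2\<close> to the quadratic error, which
  \<open>n ^ 3\<close> absorbs because \<open>n ^ 3 + n ^ 2 \<le> (n + 2) ^ 3\<close>.\<close>

lemma chain_ratio_bounds:
  assumes "0 \<le> x"
  shows "1 \<le> chain_ratio n x \<and> chain_ratio n x \<le> 1 + real n * x \<and>
    1 + real n * x - real n ^ 3 * x\<^sup>2 \<le> chain_ratio n x"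
proof (induction n rule: induct_nat_012)
  case (ge2 n)
  define r where "r = chain_ratio n x"
  define y where "y = real n * x"
  have r: "1 \<le> r" "r \<le> 1 + y" "1 + y - real n * y\<^sup>2 \<le> r" and y: "0 \<le> y"
    using ge2(1) assms by (simp_all add: r_def y_def power3_eq_cube power2_eq_square mult_ac)
  have "1 - y \<le> 1 / (1 + y)" using y by (simp add: field_simps)
  also have "\<dots> \<le> 1 / r" using r by (intro divide_left_mono) auto
  finally have 1: "1 - y \<le> 1 / r" .
  have 2: "1 / r \<le> 1 - (r - 1) + (r - 1)\<^sup>2"
  proof -
    have "1 \<le> (1 - (r - 1) + (r - 1)\<^sup>2) * r"
    proof -
      have "(1 - (r - 1) + (r - 1)\<^sup>2) * r - 1 = (r - 1) ^ 3"
        by (simp add: power2_eq_square power3_eq_cube algebra_simps)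
      moreover have "0 \<le> (r - 1) ^ 3" using r by simp
      ultimately show ?thesis by linarith
    qed
    then show ?thesis using r(1) by (simp add: pos_divide_le_eq)
  qed
  have 3: "(r - 1)\<^sup>2 \<le> y\<^sup>2" using r by (intro power_mono) auto
  have 4: "1 / r \<le> 1" using r by simp
  have 5: "real n * y\<^sup>2 + y\<^sup>2 \<le> real (Suc (Suc n)) ^ 3 * x\<^sup>2"
  proof -
    have "real n * y\<^sup>2 + y\<^sup>2 = (real n ^ 3 + real n ^ 2) * x\<^sup>2"
      by (simp add: y_def power2_eq_square power3_eq_cube algebra_simps)
    also have "\<dots> \<le> real (Suc (Suc n)) ^ 3 * x\<^sup>2"
    proof (rule mult_right_mono)
      have "(real n + 2) ^ 3 = real n ^ 3 + 6 * real n ^ 2 + 12 * real n + 8"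
        by (simp add: power2_eq_square power3_eq_cube algebra_simps)
      then show "real n ^ 3 + real n ^ 2 \<le> real (Suc (Suc n)) ^ 3" by (simp add: add.commute)
    qed simp
    finally show ?thesis .
  qed
  have "chain_ratio (Suc (Suc n)) x = 2 + 2 * x - 1 / r" by (simp add: r_def)
  moreover have "real (Suc (Suc n)) * x = y + 2 * x" by (simp add: y_def algebra_simps)
  ultimately show ?case using 1 2 3 4 5 r(3) assms by linarith
qed (use assms in auto)

lemmas chain_ratio_ge_1 = chain_ratio_bounds[THEN conjunct1]

lemma chain_ratio_pos: "0 \<le> x \<Longrightarrow> 0 < chain_ratio n x"
  using chain_ratio_ge_1[of x n] by linarith

lemma chain_ratio_mono:
  assumes "0 \<le> x" "x \<le> y"
  shows "chain_ratio n x \<le> chain_ratio n y"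
proof (induction n rule: induct_nat_012)
  case (ge2 n)
  have "1 / chain_ratio n y \<le> 1 / chain_ratio n x"
    using ge2(1) chain_ratio_pos[OF assms(1), of n] by (intro divide_left_mono) auto
  then show ?case using assms(2) by simp
qed (use assms in auto)

lemma chain_ratio_le_Suc:
  assumes "0 \<le> x"
  shows "chain_ratio n x \<le> chain_ratio (Suc n) x"
proof (induction n rule: induct_nat_012)
  case (ge2 n)
  have "1 / chain_ratio (Suc n) x \<le> 1 / chain_ratio n x"
    using ge2(1) chain_ratio_pos[OF assms, of n] by (intro divide_left_mono) auto
  then show ?case by simp
qed (use assms in auto)

lemma chain_ratio_cont: "continuous_on {0..} (chain_ratio n)"
proof (induction n rule: induct_nat_012)
  case (ge2 n)
  have "chain_ratio n x \<noteq> 0" if "x \<ge> 0" for x using chain_ratio_pos[OF that, of n] by simp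
  then show ?case using ge2(1) by (auto intro!: continuous_intros)
qed (auto intro!: continuous_intros)

text \<open>The sequence is increasing and bounded, so its limit is a fixed point of the recursion,
  that is, a root of \<open>L\<^sup>2 - 2 * (1 + x) * L + 1\<close>.\<close>

lemma chain_ratio_tendsto:
  assumes "0 \<le> x"
  shows "(\<lambda>n. chain_ratio n x) \<longlonglongrightarrow> 1 + x + sqrt (x * (x + 2))"
proof -
  have inc: "incseq (\<lambda>n. chain_ratio n x)" by (intro incseq_SucI chain_ratio_le_Suc assms)
  have "chain_ratio n x \<le> 2 * (1 + x)" for n
  proof -
    have "chain_ratio n x \<le> chain_ratio (Suc (Suc n)) x"
      using chain_ratio_le_Suc[OF assms] order_trans by blast
    also have "\<dots> \<le> 2 * (1 + x)" using chain_ratio_pos[OF assms, of n] by simp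
    finally show ?thesis .
  qed
  then obtain L where L: "(\<lambda>n. chain_ratio n x) \<longlonglongrightarrow> L" "\<And>n. chain_ratio n x \<le> L"
    using incseq_convergent[OF inc, of "2 * (1 + x)"] by blast
  have L1: "1 \<le> L" using L(2)[of 0] by simp
  have "(\<lambda>n. chain_ratio (n + 2) x) \<longlonglongrightarrow> 2 * (1 + x) - 1 / L"
    using L1 by (auto intro!: tendsto_eq_intros L(1))
  moreover have "(\<lambda>n. chain_ratio (n + 2) x) \<longlonglongrightarrow> L" using L(1) by (rule LIMSEQ_ignore_initial_segment)
  ultimately have "L = 2 * (1 + x) - 1 / L" by (metis LIMSEQ_unique)
  then have sq: "L * L + 1 = 2 * (1 + x) * L" using L1 by (simp add: field_simps)
  \<comment> \<open>\<open>1 \<le> L\<close> selects the larger root: for \<open>L < 1 + x\<close>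
    one would get \<open>L\<^sup>2 + 1 \<le> 2 * L\<^sup>2 < 2 * (1 + x) * L\<close>.\<close>
  have L2: "0 \<le> L - 1 - x"
  proof (rule ccontr)
    assume "\<not> ?thesis"
    then have a: "L < 1 + x" by simp
    have "1 \<le> L * L" using mult_mono[OF L1 L1] L1 by simp
    moreover have "L * L < L * (1 + x)" using a L1 by simp
    ultimately show False using sq by (simp add: algebra_simps)
  qed
  have "(L - 1 - x)\<^sup>2 = x * (x + 2)" using sq by (simp add: power2_eq_square algebra_simps)
  then have "L - 1 - x = sqrt (x * (x + 2))" using L2 by (metis real_sqrt_unique)
  then have "L = 1 + x + sqrt (x * (x + 2))" by simp
  then show ?thesis using L(1) by simp
qed

text \<open>The addition formula with step \<open>2 * t\<close> is the recursion of
  \<open>chain_ratio\<close> multiplied by \<open>cosh ((n + 1) * t)\<close>.\<close>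

lemma chain_ratio_cosh:
  assumes "cosh (2 * t) = 1 + x" "0 \<le> x"
  shows "chain_ratio n x * cosh ((real n - 1) * t) = cosh ((real n + 1) * t)"
proof (induction n rule: induct_nat_012)
  case 0
  have "cosh (- t) = cosh t" by simp
  then show ?case by simp
next
  case 1
  show ?case using assms(1) by simp
next
  case (ge2 n)
  have pos: "0 < chain_ratio n x" by (rule chain_ratio_pos[OF assms(2)])
  have "cosh ((real n + 1) * t + 2 * t) + cosh ((real n + 1) * t - 2 * t)
      = 2 * (1 + x) * cosh ((real n + 1) * t)"
    by (simp only: cosh_add_cosh_diff assms(1))
  moreover have "(real n + 1) * t + 2 * t = (real n + 3) * t"
    "(real n + 1) * t - 2 * t = (real n - 1) * t" by (simp_all add: algebra_simps)
  ultimately have "cosh ((real n + 3) * t)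
      = 2 * (1 + x) * cosh ((real n + 1) * t) - cosh ((real n - 1) * t)" by simp
  also have "cosh ((real n - 1) * t) = 1 / chain_ratio n x * cosh ((real n + 1) * t)"
    using ge2(1) pos by (simp add: field_simps)
  finally show ?case by (simp add: algebra_simps)
qed

section \<open>The largest eigenvalue as a crossing point of two ratios\<close>

definition star_ratio :: "nat \<Rightarrow> real \<Rightarrow> real" where
  "star_ratio s x = 1 - 2 / (real s + 1) + 2 * real s / ((real s + 1) * ((real s + 1) * x + 3))"

lemma star_ratio_antimono:
  assumes "0 \<le> x" "x \<le> y"
  shows "star_ratio s y \<le> star_ratio s x"
  unfolding star_ratio_def using assms
  by (intro add_left_mono divide_left_mono mult_left_mono add_right_mono mult_pos_pos add_nonneg_pos) auto

lemma star_ratio_strict_antimono: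
  assumes "0 < s" "0 \<le> x" "x < y"
  shows "star_ratio s y < star_ratio s x"
proof -
  have "0 < (real s + 1) * x + 3" "(real s + 1) * x + 3 < (real s + 1) * y + 3"
    using assms by (auto intro: add_nonneg_pos)
  moreover from this have "0 < (real s + 1) * y + 3" by linarith
  ultimately show ?thesis unfolding star_ratio_def using assms
    by (intro add_strict_left_mono divide_strict_left_mono mult_strict_left_mono mult_pos_pos) auto
qed

lemma star_ratio_cont: "continuous_on {0..} (star_ratio s)"
proof -
  have "(real s + 1) * ((real s + 1) * x + 3) \<noteq> 0" if "0 \<le> x" for x
    using that by (smt (verit) mult_nonneg_nonneg mult_eq_0_iff of_nat_0_le_iff)
  then show ?thesis unfolding star_ratio_def by (auto intro!: continuous_intros)
qed

lemma lambda_T_eq_of_ratio: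
  assumes x: "0 \<le> x" and l: "2 \<le> l" and eq: "chain_ratio l x = star_ratio s x"
  shows "lambda_T s l = x"
proof -
  obtain n where n: "l = Suc (Suc n)" using l by (metis Suc_le_D numeral_2_eq_2 Suc_le_mono)
  \<comment> \<open>\<open>t\<close> is real because \<open>0 \<le> x\<close>.\<close>
  define t where "t = arcosh (1 + x) / 2"
  have t: "cosh (2 * t) = 1 + x" using x by (simp add: t_def)
  \<comment> \<open>The profile is centred at the middle of the chain, so \<open>c\<close> is
    invariant under \<open>i \<mapsto> n + 1 - i\<close>; its step \<open>2 * t\<close> yields the
    factor \<open>2 * (1 + x)\<close> in the recurrence.\<close>
  define c where "c i = cosh ((2 * real i - real n - 1) * t)" for i
  define d where "d = real s + 1"
  define u where "u = c 0 / (d * x + 3)"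
  have d: "d > 0" "d * x + 3 > 0" using x by (auto simp: d_def add_nonneg_pos)
  have u: "c 0 = (d * x + 3) * u" using d by (simp add: u_def)
  have c_pos: "0 < c i" for i by (simp add: c_def)
  have c0: "c 0 = cosh ((real l - 1) * t)"
    using cosh_minus[of "(real n + 1) * t"] by (simp add: c_def n algebra_simps)
  have three: "c i + c (Suc (Suc i)) = 2 * (1 + x) * c (Suc i)" for i
  proof -
    define a where "a = (2 * real i + 1 - real n) * t"
    have "c i = cosh (a - 2 * t)" "c (Suc (Suc i)) = cosh (a + 2 * t)" "c (Suc i) = cosh a"
      unfolding c_def a_def by (rule arg_cong[where f = cosh], simp add: algebra_simps)+
    then show ?thesis using cosh_add_cosh_diff[of a "2 * t"] by (simp only: t add.commute)
  qed
  \<comment> \<open>The left-hand side is the recurrence at the first edge, extended to a fictitious edge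
    with index \<open>-1\<close>.\<close>
  have ext: "star_ratio s x * c 0 + c 1 = 2 * (1 + x) * c 0"
  proof -
    have "star_ratio s x * c 0 = cosh ((real l + 1) * t)"
      using chain_ratio_cosh[OF t x, of l] by (simp add: eq c0)
    moreover have "c 1 = cosh ((real l - 1) * t - 2 * t)"
      using cosh_minus[of "(real n - 1) * t"] by (simp add: c_def n algebra_simps)
    moreover have "(real l + 1) * t = (real l - 1) * t + 2 * t" by (simp add: algebra_simps)
    ultimately show ?thesis
      using cosh_add_cosh_diff[of "(real l - 1) * t" "2 * t"] by (simp only: t c0)
  qed
  \<comment> \<open>The fictitious value equals \<open>c 0 + 2 * (s * u - c 0) / d\<close>, so
    \<open>ext\<close> is the center equation doubled and rearranged.\<close>
  have "star_ratio s x * c 0 = (1 - 2 / d) * c 0 + 2 * real s * u / d"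
    using d unfolding star_ratio_def d_def[symmetric] u_def by (simp add: field_simps)
  with ext have center: "(real s * u - c 0) / d + (c 1 - c 0) / 2 = x * c 0"
    by (simp add: algebra_simps diff_divide_distrib)
  show ?thesis unfolding n
  proof (rule lambda_T_eqI[where c = c and u = u])
    show "c (Suc n) = c 0" "c n = c 1"
      using cosh_minus[of "(real n + 1) * t"] cosh_minus[of "(real n - 1) * t"]
      by (simp_all add: c_def algebra_simps)
    show "0 < u" using d c_pos by (simp add: u_def)
    show "c 0 = ((real s + 1) * x + 3) * u" using u by (simp add: d_def)
    show "(real s * u - c 0) / (real s + 1) + (c 1 - c 0) / 2 = x * c 0"
      using center by (simp add: d_def)
  qed (rule c_pos three)+
qed

text \<open>The graphs cross between \<open>0\<close> and \<open>1\<close>. At \<open>0\<close> the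
  star ratio exceeds \<open>1\<close> by \<open>(2 * s - 6) / (3 * (s + 1))\<close>, which is
  positive since \<open>3 < s\<close>; at \<open>1\<close> it has dropped below
  \<open>1\<close>.\<close>

lemma lambda_T_ratio:
  assumes s: "3 < s" and l: "2 \<le> l"
  shows "0 < lambda_T s l" "chain_ratio l (lambda_T s l) = star_ratio s (lambda_T s l)"
proof -
  define f where "f x = chain_ratio l x - star_ratio s x" for x
  have r0: "chain_ratio l 0 = 1" using chain_ratio_bounds[of 0 l] by simp
  have "star_ratio s 0 = 1 + (2 * real s - 6) / (3 * (real s + 1))"
    unfolding star_ratio_def by (simp add: divide_simps) (simp add: algebra_simps)
  moreover have "0 < (2 * real s - 6) / (3 * (real s + 1))" using s by simp
  ultimately have f0: "f 0 < 0" by (simp add: f_def r0)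
  have s1: "star_ratio s 1 < 1" unfolding star_ratio_def by (simp add: divide_simps) (simp add: algebra_simps)
  have "0 \<le> f 1" using s1 chain_ratio_ge_1[of 1 l] by (simp add: f_def)
  moreover have "continuous_on {0..1} f" unfolding f_def
    using continuous_on_subset[OF chain_ratio_cont, of "{0..1}"]
      continuous_on_subset[OF star_ratio_cont, of "{0..1}"]
    by (intro continuous_intros) auto
  ultimately obtain x where x: "0 \<le> x" "f x = 0" using IVT'[of f 0 0 1] f0 by auto
  then have "x \<noteq> 0" using f0 by auto
  moreover have "lambda_T s l = x" using x l by (intro lambda_T_eq_of_ratio) (simp_all add: f_def)
  ultimately show "0 < lambda_T s l" "chain_ratio l (lambda_T s l) = star_ratio s (lambda_T s l)"
    using x by (simp_all add: f_def)
qed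

text \<open>Together with its converse below, this locates the crossing point from the order of the
  two ratios at an explicit test point.\<close>

lemma le_lambda_T:
  assumes "3 < s" "2 \<le> l" "0 \<le> x" "chain_ratio l x < star_ratio s x"
  shows "x \<le> lambda_T s l"
proof (rule ccontr)
  assume "\<not> ?thesis"
  then have "chain_ratio l (lambda_T s l) \<le> chain_ratio l x" "star_ratio s x \<le> star_ratio s (lambda_T s l)"
    using lambda_T_ratio(1)[OF assms(1,2)] by (auto intro!: chain_ratio_mono star_ratio_antimono)
  then show False using lambda_T_ratio(2)[OF assms(1,2)] assms(4) by linarith
qed

lemma lambda_T_le:
  assumes "3 < s" "2 \<le> l" "0 \<le> x" "star_ratio s x < chain_ratio l x"
  shows "lambda_T s l \<le> x"
proof (rule ccontr)
  assume "\<not> ?thesis"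
  then have "chain_ratio l x \<le> chain_ratio l (lambda_T s l)" "star_ratio s (lambda_T s l) \<le> star_ratio s x"
    using assms(3) by (auto intro!: chain_ratio_mono star_ratio_antimono)
  then show False using lambda_T_ratio(2)[OF assms(1,2)] assms(4) by linarith
qed

section \<open>Large stars with a chain of fixed length\<close>

text \<open>For \<open>x = D / d\<close> the leading terms of the two ratios are
  \<open>1 + k * D / d\<close> and \<open>1 + 2 / D\<close>; equating them gives
  \<open>k * D\<^sup>2 = 2 * d\<close>. Shifting \<open>D\<close> by constants depending only on
  \<open>k\<close> absorbs all errors.\<close>

lemma lambda_T_bounds:
  assumes l: "2 \<le> l" and s: "50 * l ^ 3 \<le> s"
  shows "\<bar>lambda_T s l - sqrt (2 / (real l * (real s + 1)))\<bar> \<le> 5 * real l / (real s + 1)"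
proof -
  define k where "k = real l"
  define d where "d = real s + 1"
  define D where "D = d * sqrt (2 / (k * d))"
  have k: "2 \<le> k" using l by (simp add: k_def)
  have "real (50 * l ^ 3) \<le> real s" using s by linarith
  then have dk: "50 * k ^ 3 < d" by (simp add: k_def d_def)
  have k3: "2 * 2 * k \<le> k ^ 3" unfolding power3_eq_cube using k by (intro mult_mono) auto
  have d: "400 < d" "5 * k < d" using dk k3 k by linarith+
  have D2: "k * D\<^sup>2 = 2 * d"
  proof -
    have "D\<^sup>2 = d\<^sup>2 * (2 / (k * d))" using k d unfolding D_def power_mult_distrib by simp
    then show ?thesis using k d by (simp add: power2_eq_square)
  qed
  have D: "3 \<le> D"
  proof (rule power2_le_imp_le)
    have "k * 3\<^sup>2 \<le> k * D\<^sup>2" unfolding D2 using d dk k3 k by simp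
    then show "3\<^sup>2 \<le> D\<^sup>2" using k by simp
    show "0 \<le> D" using d k by (simp add: D_def)
  qed
  have s3: "3 < s" using d(1) by (simp add: d_def)
  have root: "sqrt (2 / (k * d)) = D / d" using d by (simp add: D_def)
  have kD: "k * D = 2 * d / D" using D2 D by (simp add: power2_eq_square field_simps)
  \<comment> \<open>The shift by \<open>3\<close> turns \<open>d * x + 3\<close> into
    \<open>D\<close>. In units of \<open>1 / d\<close> it lowers the chain side by
    \<open>3 * k \<ge> 6\<close>, while the star side loses
    \<open>2 + 2 / D \<le> 3\<close>.\<close>
  have "(D - 3) / d \<le> lambda_T s l"
  proof (rule le_lambda_T[OF s3 l])
    show "0 \<le> (D - 3) / d" using D d by simp
    have "star_ratio s ((D - 3) / d) = 1 - 2 / d + 2 * (d - 1) / (d * D)"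
      using d by (simp add: star_ratio_def d_def[symmetric]) (simp add: d_def)
    also have "\<dots> = 1 + (k * D - 2 - 2 / D) / d"
      using d D unfolding kD by (simp add: field_simps)
    also have "\<dots> > 1 + k * ((D - 3) / d)"
    proof -
      have "2 / D \<le> 1" using D by simp
      then have "k * (D - 3) < k * D - 2 - 2 / D" using k by (simp add: algebra_simps)
      then show ?thesis using d by (simp add: divide_strict_right_mono)
    qed
    finally show "chain_ratio l ((D - 3) / d) < star_ratio s ((D - 3) / d)"
      using chain_ratio_bounds[OF \<open>0 \<le> (D - 3) / d\<close>, of l] by (simp add: k_def)
  qed
  \<comment> \<open>The shift gains \<open>5 * k\<^sup>2 / d\<close> on the chain side, which must
    beat the quadratic error \<open>k ^ 3 * x\<^sup>2\<close>. That error is about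
    \<open>k ^ 3 * D\<^sup>2 / d\<^sup>2 = 2 * k\<^sup>2 / d\<close>, at most doubled by the
    estimate of the square below, plus a remainder controlled by
    \<open>50 * k ^ 3 < d\<close>.\<close>
  moreover have "lambda_T s l \<le> (D + 5 * k) / d"
  proof (rule lambda_T_le[OF s3 l])
    show pos: "0 \<le> (D + 5 * k) / d" using D d k by simp
    have "star_ratio s ((D + 5 * k) / d) = 1 - 2 / d + 2 * (d - 1) / (d * (D + 5 * k + 3))"
      using d by (simp add: star_ratio_def d_def[symmetric]) (simp add: d_def)
    also have "\<dots> \<le> 1 + 2 * d / (d * D)"
    proof -
      have "2 * (d - 1) / (d * (D + 5 * k + 3)) \<le> 2 * d / (d * D)"
        using d D k by (intro frac_le mult_left_mono) auto
      moreover have "0 \<le> 2 / d" using d by simp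
      ultimately show ?thesis by linarith
    qed
    also have "\<dots> = 1 + k * D / d" unfolding kD using d by simp
    also have "\<dots> < 1 + k * ((D + 5 * k) / d) - k ^ 3 * ((D + 5 * k) / d)\<^sup>2"
    proof -
      have "(D + 5 * k)\<^sup>2 + (D - 5 * k)\<^sup>2 = 2 * D\<^sup>2 + 50 * k\<^sup>2"
        by (simp add: power2_eq_square algebra_simps)
      then have "(D + 5 * k)\<^sup>2 \<le> 2 * D\<^sup>2 + 50 * k\<^sup>2" using zero_le_power2[of "D - 5 * k"] by linarith
      then have "k * (D + 5 * k)\<^sup>2 \<le> k * (2 * D\<^sup>2 + 50 * k\<^sup>2)"
        using k by (intro mult_left_mono) auto
      also have "\<dots> = 4 * d + 50 * k ^ 3"
        using D2 by (simp add: algebra_simps power2_eq_square power3_eq_cube)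
      also have "\<dots> < 5 * d" using dk by simp
      finally have "k\<^sup>2 * (k * (D + 5 * k)\<^sup>2) < k\<^sup>2 * (5 * d)" using k by simp
      then have "k ^ 3 * (D + 5 * k)\<^sup>2 / d\<^sup>2 < k\<^sup>2 * (5 * d) / d\<^sup>2"
        using d by (intro divide_strict_right_mono) (auto simp: power2_eq_square power3_eq_cube mult_ac)
      also have "k\<^sup>2 * (5 * d) / d\<^sup>2 = k * (5 * k) / d" using d by (simp add: power2_eq_square)
      also have "\<dots> = k * ((D + 5 * k) / d) - k * D / d"
        by (simp add: add_divide_distrib distrib_left)
      finally show ?thesis by (simp add: power_divide)
    qed
    also have "\<dots> \<le> chain_ratio l ((D + 5 * k) / d)"
      using chain_ratio_bounds[OF pos, of l] by (simp add: k_def)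
    finally show "star_ratio s ((D + 5 * k) / d) < chain_ratio l ((D + 5 * k) / d)" .
  qed
  moreover have "3 / d \<le> 5 * k / d" using k d by (intro divide_right_mono) auto
  ultimately show ?thesis
    unfolding k_def[symmetric] d_def[symmetric] root by (simp add: diff_divide_distrib add_divide_distrib)
qed

lemma lambda_T_asymp:
  assumes "2 \<le> l"
  shows "(\<lambda>s. lambda_T s l - sqrt (2 / (real l * (real s + 1)))) \<in> O(\<lambda>s. 1 / (real s + 1))"
proof (rule bigoI)
  show "eventually (\<lambda>s. norm (lambda_T s l - sqrt (2 / (real l * (real s + 1))))
      \<le> 5 * real l * norm (1 / (real s + 1))) at_top"
    using eventually_ge_at_top[of "50 * l ^ 3"]
    by eventually_elim (use lambda_T_bounds[OF assms] in simp)
qed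

section \<open>Chains of unbounded length\<close>

text \<open>\<open>chain_ratio\<close> increases with \<open>l\<close>, so the crossing point moves
  to the left while staying positive. Convergence gives the \<open>lim\<close> in
  \<open>lambda_T_inf\<close> its intended meaning.\<close>

lemma lambda_T_LIMSEQ:
  assumes s: "3 < s"
  shows "(\<lambda>l. lambda_T s l) \<longlonglongrightarrow> lambda_T_inf s"
proof -
  have "lambda_T s (Suc l) \<le> lambda_T s l" if l: "2 \<le> l" for l
  proof (rule ccontr)
    let ?x = "lambda_T s l" and ?y = "lambda_T s (Suc l)"
    have x: "0 < ?x" "chain_ratio l ?x = star_ratio s ?x" using lambda_T_ratio[OF s l] by auto
    assume "\<not> ?thesis"
    then have less: "?x < ?y" by simp
    have "chain_ratio (Suc l) ?y = star_ratio s ?y" using lambda_T_ratio(2)[OF s, of "Suc l"] l by simp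
    also have "\<dots> < star_ratio s ?x" using star_ratio_strict_antimono[OF _ _ less] s x(1) by simp
    also have "\<dots> \<le> chain_ratio (Suc l) ?x"
      unfolding x(2)[symmetric] using x(1) by (intro chain_ratio_le_Suc) simp
    also have "\<dots> \<le> chain_ratio (Suc l) ?y" using x(1) less by (intro chain_ratio_mono) auto
    finally show False by simp
  qed
  \<comment> \<open>The shift by \<open>2\<close> restricts to lengths for which the crossing-point
    description holds.\<close>
  then have "decseq (\<lambda>l. lambda_T s (l + 2))" by (intro decseq_SucI) simp
  moreover have "0 \<le> lambda_T s (l + 2)" for l using lambda_T_ratio(1)[OF s, of "l + 2"] by simp
  ultimately obtain L where "(\<lambda>l. lambda_T s (l + 2)) \<longlonglongrightarrow> L"
    using decseq_convergent by blast
  then have "(\<lambda>l. lambda_T s l) \<longlonglongrightarrow> L" by (rule LIMSEQ_offset)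
  then show ?thesis by (simp add: lambda_T_inf_def limI)
qed

text \<open>An increasing sequence stays below its limit, so the test-point inequality holds for
  every \<open>l\<close>.\<close>

lemma le_lambda_T_inf:
  assumes s: "3 < s" and x: "0 \<le> x" and less: "1 + x + sqrt (x * (x + 2)) < star_ratio s x"
  shows "x \<le> lambda_T_inf s"
proof (rule LIMSEQ_le_const[OF lambda_T_LIMSEQ[OF s]])
  have "incseq (\<lambda>n. chain_ratio n x)" by (intro incseq_SucI chain_ratio_le_Suc x)
  then have "chain_ratio l x < star_ratio s x" for l
    using incseq_le[OF _ chain_ratio_tendsto[OF x]] less by (meson le_less_trans)
  then show "\<exists>N. \<forall>l\<ge>N. x \<le> lambda_T s l" using le_lambda_T[OF s _ x] by blast
qed

text \<open>In this direction the strict inequality passes from the limit only to large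
  \<open>l\<close>, which suffices.\<close>

lemma lambda_T_inf_le:
  assumes s: "3 < s" and x: "0 \<le> x" and less: "star_ratio s x < 1 + x + sqrt (x * (x + 2))"
  shows "lambda_T_inf s \<le> x"
proof (rule tendsto_upperbound[OF lambda_T_LIMSEQ[OF s]])
  have "eventually (\<lambda>l. star_ratio s x < chain_ratio l x) at_top"
    by (rule order_tendstoD(1)[OF chain_ratio_tendsto[OF x] less])
  then show "eventually (\<lambda>l. lambda_T s l \<le> x) at_top"
    using eventually_ge_at_top[of 2] by eventually_elim (use lambda_T_le[OF s _ x] in blast)
qed simp

section \<open>Large stars with an infinite chain\<close>

text \<open>With \<open>d = s + 1\<close> and \<open>x = k * d powr (- 2 / 3)\<close>, the
  deviations from \<open>1\<close> are \<open>2 / (d * x)\<close> and \<open>sqrt (2 * x)\<close> to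
  leading order, both of size \<open>d powr (- 1 / 3)\<close>; this balance dictates the exponent
  \<open>- 2 / 3\<close>.\<close>

lemma star_ratio_infinite_chain_tendsto:
  assumes "0 < k"
  shows "(\<lambda>s. (real s + 1) powr (1 / 3) * (star_ratio s (k * (real s + 1) powr (- 2 / 3))
      - (1 + k * (real s + 1) powr (- 2 / 3) + sqrt (k * (real s + 1) powr (- 2 / 3) *
          (k * (real s + 1) powr (- 2 / 3) + 2))))) \<longlonglongrightarrow> 2 * inverse k - (k * 2) powr (1 / 2)"
  unfolding star_ratio_def using assms by real_asymp

text \<open>The limit \<open>2 / k - sqrt (2 * k)\<close> changes sign at \<open>k ^ 3 = 2\<close>,
  as squaring shows; its sign decides on which side of the eigenvalue the test point eventually
  lies.\<close>

lemma eventually_le_lambda_T_inf: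
  assumes k: "0 < k" "k ^ 3 < 2"
  shows "eventually (\<lambda>s. k * (real s + 1) powr (- 2 / 3) \<le> lambda_T_inf s) at_top"
proof -
  have "(k * 2) powr (1 / 2) < 2 * inverse k"
  proof -
    have "k * 2 * k\<^sup>2 < 4" using k(2) by (simp add: power2_eq_square power3_eq_cube)
    then have "k * 2 < (2 / k)\<^sup>2" using k(1) by (simp add: power_divide pos_less_divide_eq)
    then have "sqrt (k * 2) < 2 / k" using k(1) by (intro real_less_lsqrt) auto
    then show ?thesis using k by (simp add: powr_half_sqrt divide_inverse[of 2 k, symmetric])
  qed
  then have "0 < 2 * inverse k - (k * 2) powr (1 / 2)" by simp
  from order_tendstoD(1)[OF star_ratio_infinite_chain_tendsto[OF k(1)] this]
  show ?thesis using eventually_gt_at_top[of 3]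
  proof eventually_elim
    case (elim s)
    then show ?case using k by (intro le_lambda_T_inf) (auto simp: zero_less_mult_iff)
  qed
qed

lemma eventually_lambda_T_inf_le:
  assumes k: "0 < k" "2 < k ^ 3"
  shows "eventually (\<lambda>s. lambda_T_inf s \<le> k * (real s + 1) powr (- 2 / 3)) at_top"
proof -
  have "2 * inverse k < (k * 2) powr (1 / 2)"
  proof -
    have "4 < k * 2 * k\<^sup>2" using k(2) by (simp add: power2_eq_square power3_eq_cube)
    then have "(2 / k)\<^sup>2 < k * 2" using k(1) by (simp add: power_divide pos_divide_less_eq)
    then have "2 / k < sqrt (k * 2)" by (rule real_less_rsqrt)
    then show ?thesis using k by (simp add: powr_half_sqrt divide_inverse[of 2 k, symmetric])
  qed
  then have "2 * inverse k - (k * 2) powr (1 / 2) < 0" by simp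
  from order_tendstoD(2)[OF star_ratio_infinite_chain_tendsto[OF k(1)] this]
  show ?thesis using eventually_gt_at_top[of 3]
  proof eventually_elim
    case (elim s)
    then show ?case using k by (intro lambda_T_inf_le) (auto simp: mult_less_0_iff)
  qed
qed

lemma lambda_T_inf_asymp:
  "(\<lambda>s. lambda_T_inf s - 2 powr (1 / 3) * (real s + 1) powr (- 2 / 3))
    \<in> o(\<lambda>s. (real s + 1) powr (- 2 / 3))"
proof (rule landau_o.smallI)
  fix \<epsilon> :: real assume \<epsilon>: "\<epsilon> > 0"
  define a :: real where "a = 2 powr (1 / 3)"
  have a: "0 < a" "a ^ 3 = 2" by (simp_all add: a_def powr_realpow[symmetric] powr_powr)
  \<comment> \<open>The cap \<open>a / 2\<close> keeps the lower factor \<open>a - h\<close>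
    positive.\<close>
  define h where "h = min \<epsilon> (a / 2)"
  have h: "0 < h" "h \<le> \<epsilon>" "0 < a - h" using \<epsilon> a by (auto simp: h_def min_def)
  have "(a - h) ^ 3 < 2" "2 < (a + h) ^ 3"
    using power_strict_mono[of "a - h" a 3] power_strict_mono[of a "a + h" 3] h a by auto
  then have "eventually (\<lambda>s. (a - h) * (real s + 1) powr (- 2 / 3) \<le> lambda_T_inf s) at_top"
    "eventually (\<lambda>s. lambda_T_inf s \<le> (a + h) * (real s + 1) powr (- 2 / 3)) at_top"
    using eventually_le_lambda_T_inf[of "a - h"] eventually_lambda_T_inf_le[of "a + h"] h a by simp_all
  then show "eventually (\<lambda>s. norm (lambda_T_inf s - 2 powr (1 / 3) * (real s + 1) powr (- 2 / 3))
      \<le> \<epsilon> * norm ((real s + 1) powr (- 2 / 3))) at_top"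
  proof eventually_elim
    case (elim s)
    define p where "p = (real s + 1) powr (- 2 / 3)"
    have "h * p \<le> \<epsilon> * p" using h by (intro mult_right_mono) (auto simp: p_def)
    moreover have "0 \<le> p" by (simp add: p_def)
    ultimately show ?case
      using elim unfolding a_def[symmetric] p_def[symmetric] by (simp add: algebra_simps)
  qed
qed

theorem proposition5:
  shows "(\<forall>s::nat. s \<ge> 1 \<longrightarrow> lambda_T s 2 = (sqrt (real s + 1) - 2) / (real s + 1)) \<and>
    (\<forall>l::nat. l \<ge> 2 \<longrightarrow>
      (\<lambda>s::nat. lambda_T s l - sqrt (2 / (real l * (real s + 1))))
        \<in> O[at_top](\<lambda>s. 1 / (real s + 1))) \<and>
    (\<forall>s::nat. s > 3 \<longrightarrow> (\<lambda>l. lambda_T s l) \<longlonglongrightarrow> lambda_T_inf s) \<and>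
    (\<lambda>s::nat. lambda_T_inf s - 2 powr (1 / 3) * (real s + 1) powr (- 2 / 3))
        \<in> o[at_top](\<lambda>s. (real s + 1) powr (- 2 / 3))"
  using lambda_T_2 lambda_T_asymp lambda_T_LIMSEQ lambda_T_inf_asymp by blast

end
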